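(* Fix $d\ge 1$. Let $Q$ be an interval in $\mathbb N^d$ with $n$ minima and let $P\subseteq Q$ be an initial scaffold of $Q$. Then (i) $|P|=\Theta(n)$ if $d\le 3$; that is, there are constants $c,C>0$ depending only on $d$ with $cn\le |P|\le Cn$ for all such $Q$ and $P$; (ii) $|P|=\Theta(n^2)$ in the worst case if $d>3$; that is, there is a constant $C>0$ depending only on $d$ with $|P|\le Cn^2$ for all such $Q$ and $P$, and this is asymptotically tight: letting $s_d(n)$ be the maximum of $|P|$ over all intervals $Q\subseteq\mathbb N^d$ with exactly $n$ minima and initial scaffolds $P$ of $Q$, one has $s_d(n)=\Theta(n^2)$.
   Context: $\mathbb N=\{0,1,2,\dots\}$ and $\mathbb N^d$ has the product partial order. A subposet $P\subseteq Q$ is a poset whose elements are elements of $Q$ and whose relations are relations of $Q$ (not necessarily all). A minimum means a minimal element. A poset is connected if it is nonempty and any two elements are joined by a finite sequence of elements in which consecutive elements are comparable; otherwise (in particular if empty) it is disconnected. A component is a maximal connected subposet. An interval $Q\subseteq \mathbb N^d$ is a nonempty connected subset, with the full inherited order, such that $p\le q\le r$ with $p,r\in Q$ and $q\in\mathbb N^d$ implies $q\in Q$. For $q\in Q$, $\operatorname{dn}(q)=\{p\in Q\mid p<q\}$ with the full inherited order, and $I_Q=\{q\in Q\mid \operatorname{dn}(q)\text{ is disconnected}\}$ (this contains all minima). An initial scaffold of $Q$ is a subposet $P\subseteq Q$ with set of elements $I_Q$ such that for each $p\in P$ and each component $A$ of $\operatorname{dn}(p)$, $P$ contains exactly one relation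 $m<p$ with $m\in A$, and this $m$ is a minimum of $Q$; $P$ has no other non-identity relations. $|P|$ denotes the number of relations $p\le p'$ in $P$, including the identity relations $p\le p$. The dimension $d$ is treated as a constant. *)

theory Defs
  imports Complex_Main "HOL-Library.Landau_Symbols"
begin

text \<open>A poset is given by its reflexive order relation, a set of pairs \<open>r\<close> with
  \<open>Partial_order r\<close>. Its elements are \<open>Field r\<close>, and its number of relations (identity
  relations included) is \<open>card r\<close>.\<close>

definition full_order :: "'a::order set \<Rightarrow> 'a rel" where
  "full_order S = {(x, y). x \<in> S \<and> y \<in> S \<and> x \<le> y}"

text \<open>A subposet need not carry the full inherited order.\<close>

definition subposet :: "'a rel \<Rightarrow> 'a rel \<Rightarrow> bool" where
  "subposet P Q \<longleftrightarrow> Partial_order P \<and> P \<subseteq> Q"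

text \<open>The empty poset is disconnected.\<close>

definition connected_poset :: "'a rel \<Rightarrow> bool" where
  "connected_poset r \<longleftrightarrow>
     Field r \<noteq> {} \<and> (\<forall>x\<in>Field r. \<forall>y\<in>Field r. (x, y) \<in> (r \<union> r\<inverse>)\<^sup>*)"

definition poset_component :: "'a rel \<Rightarrow> 'a rel \<Rightarrow> bool" where
  "poset_component A r \<longleftrightarrow> subposet A r \<and> connected_poset A \<and>
     (\<forall>B. subposet B r \<and> connected_poset B \<and> subposet A B \<longrightarrow> B = A)"

text \<open>The points of \<open>\<nat>\<^sup>d\<close> are the functions vanishing outside \<open>{..<d}\<close>; on them the
  pointwise order of functions is the product order.\<close>

definition Nd :: "nat \<Rightarrow> (nat \<Rightarrow> nat) set" where
  "Nd d = {x. \<forall>i\<ge>d. x i = 0}"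

definition interval_in :: "nat \<Rightarrow> (nat \<Rightarrow> nat) set \<Rightarrow> bool" where
  "interval_in d Q \<longleftrightarrow> Q \<subseteq> Nd d \<and> connected_poset (full_order Q) \<and>
     (\<forall>p\<in>Q. \<forall>r\<in>Q. \<forall>q\<in>Nd d. p \<le> q \<and> q \<le> r \<longrightarrow> q \<in> Q)"

text \<open>For \<open>Q \<subseteq> Nd d\<close> this set is an antichain, hence finite by Dickson's lemma, so its
  cardinality \<open>card\<close> is never the default value of an infinite set.\<close>

definition minima :: "'a::order set \<Rightarrow> 'a set" where
  "minima Q = {q \<in> Q. \<not> (\<exists>p\<in>Q. p < q)}"

definition dn :: "'a::order set \<Rightarrow> 'a \<Rightarrow> 'a rel" where
  "dn Q q = full_order {p \<in> Q. p < q}"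

definition disconnected_points :: "'a::order set \<Rightarrow> 'a set" where
  "disconnected_points Q = {q \<in> Q. \<not> connected_poset (dn Q q)}"

definition initial_scaffold :: "'a::order rel \<Rightarrow> 'a set \<Rightarrow> bool" where
  "initial_scaffold P Q \<longleftrightarrow>
     subposet P (full_order Q) \<and>
     Field P = disconnected_points Q \<and>
     (\<forall>p\<in>Field P. \<forall>A. poset_component A (dn Q p) \<longrightarrow>
        (\<exists>m\<in>minima Q. {m' \<in> Field A. (m', p) \<in> P} = {m})) \<and>
     (\<forall>(m, p)\<in>P. m \<noteq> p \<longrightarrow> (\<exists>A. poset_component A (dn Q p) \<and> m \<in> Field A))"

definition max_scaffold_size :: "nat \<Rightarrow> nat \<Rightarrow> nat" where
  "max_scaffold_size d n =
     Max {card P |P Q. interval_in d Q \<and> card (minima Q) = n \<and> initial_scaffold P Q}"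

end

theory Submission
  imports Defs
begin

text \<open>Let \<open>q\<close> be a point of the interval \<open>Q\<close>, and say that a point below \<open>q\<close> drops in the coordinates
  in which it is smaller than \<open>q\<close>. Two points below \<open>q\<close> that drop in a common coordinate have a join
  still strictly below \<open>q\<close>, so they lie in the same component of \<open>dn Q q\<close>. Every bound from above
  comes from this remark.

  Since each point below \<open>q\<close> drops somewhere, \<open>dn Q q\<close> has at most \<open>d\<close> components, and a scaffold has
  at most \<open>d\<close> nonidentity relations ending in a given point (\<open>card_scaffold_le\<close>). So up to a
  constant, the size of a scaffold is the number of disconnected points. If \<open>q\<close> is disconnected but
  not minimal, two minima in different components have no common drop, so \<open>q\<close> is their join;
  this leaves at most quadratically many such \<open>q\<close> (\<open>card_disconnected_points_le_square\<close>).

  In at most three coordinates, one of two components owns a single coordinate \<open>i\<close>: all points that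
  drop in \<open>i\<close> agree with \<open>q\<close> elsewhere. Such a \<open>q\<close> lies on the ray that leaves a minimum \<open>m\<close> in
  direction \<open>i\<close>, at the first place where the ray dominates a second minimum. It is therefore
  determined by \<open>m\<close> and \<open>i\<close>, which leaves a linear number
  (\<open>card_disconnected_points_le_linear\<close>).

  In four or more coordinates, minima \<open>(i, n - i, 0, 0)\<close> and \<open>(0, 0, j, n - j)\<close> can be paired
  freely: all their joins are different and disconnected
  (\<open>ex_interval_many_disconnected_points\<close>), so the quadratic bound is attained up to a
  constant.

  The bounds count minima by \<open>card\<close>, and they would be void if \<open>card\<close> returned its default value on
  an infinite set; this is excluded by Dickson's lemma (\<open>finite_antichain_Nd\<close>).\<close>

section \<open>Orders, connectedness and components\<close>

lemma Field_full_order [simp]: "Field (full_order S) = S"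
  unfolding full_order_def Field_def by auto

lemma full_order_mono: "S \<subseteq> T \<Longrightarrow> full_order S \<subseteq> full_order T"
  unfolding full_order_def by auto

lemma Partial_order_full_order: "Partial_order (full_order S)"
  unfolding partial_order_on_def preorder_on_def refl_on_def trans_def antisym_def
  by (auto simp: full_order_def Field_def)

abbreviation linked :: "'a rel \<Rightarrow> 'a \<Rightarrow> 'a \<Rightarrow> bool" where
  "linked r x y \<equiv> (x, y) \<in> (r \<union> r\<inverse>)\<^sup>*"

lemma linked_sym: "linked r x y \<Longrightarrow> linked r y x"
  by (rule symD[OF sym_rtrancl]) (simp_all add: sym_Un_converse)

lemma linked_trans: "linked r x y \<Longrightarrow> linked r y z \<Longrightarrow> linked r x z"
  by (rule rtrancl_trans)

lemma linked_mono: "linked r x y \<Longrightarrow> r \<subseteq> s \<Longrightarrow> linked s x y"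
  by (meson Un_mono converse_mono rtrancl_mono subsetD)

lemma linked_if_le: "x \<in> S \<Longrightarrow> y \<in> S \<Longrightarrow> x \<le> y \<Longrightarrow> linked (full_order S) x y"
  by (rule r_into_rtrancl) (simp add: full_order_def)

lemma linked_if_common_upper_bound:
  assumes "x \<in> S" "y \<in> S" "z \<in> S" "x \<le> z" "y \<le> z"
  shows "linked (full_order S) x y"
  using assms by (blast intro: linked_trans linked_sym linked_if_le)

lemma connected_poset_invariant:
  assumes "connected_poset r" "x \<in> Field r" "y \<in> Field r"
    and inv: "\<And>u v. (u, v) \<in> r \<Longrightarrow> \<Phi> u \<longleftrightarrow> \<Phi> v"
  shows "\<Phi> x \<longleftrightarrow> \<Phi> y"
proof -
  have "linked r x y"
    using assms by (simp add: connected_poset_def)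
  then show ?thesis
    by (induction rule: rtrancl_induct) (use inv in auto)
qed

lemma connected_poset_union:
  assumes A: "connected_poset A" "A \<subseteq> full_order S"
    and B: "connected_poset B" "B \<subseteq> full_order S"
    and x: "x \<in> Field A" "x \<in> Field B"
  shows "connected_poset (full_order (Field A \<union> Field B))"
proof -
  let ?U = "Field A \<union> Field B"
  have "A \<subseteq> full_order ?U" "B \<subseteq> full_order ?U"
    using A(2) B(2) by (auto simp: full_order_def intro: FieldI1 FieldI2)
  moreover have "linked A x u \<or> linked B x u" if "u \<in> ?U" for u
    using that A(1) B(1) x unfolding connected_poset_def by blast
  ultimately have "linked (full_order ?U) x u" if "u \<in> ?U" for u
    using that linked_mono by metis
  then have "linked (full_order ?U) u v" if "u \<in> ?U" "v \<in> ?U" for u v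
    using that linked_trans linked_sym by metis
  then show ?thesis
    using x unfolding connected_poset_def Field_full_order by blast
qed

text \<open>Adjoining to a component any connected subposet that meets it, and filling in all inherited
  relations, gives a connected subposet again; by maximality nothing new was adjoined.\<close>

lemma component_absorbs:
  assumes A: "poset_component A (full_order S)"
    and B: "connected_poset B" "B \<subseteq> full_order S"
    and x: "x \<in> Field A" "x \<in> Field B"
  shows "B \<subseteq> A"
proof -
  let ?C = "full_order (Field A \<union> Field B)"
  have A': "Partial_order A" "A \<subseteq> full_order S" "connected_poset A"
    using A by (auto simp: poset_component_def subposet_def)
  have "Field A \<union> Field B \<subseteq> S"
    using mono_Field[OF A'(2)] mono_Field[OF B(2)] by auto
  then have "subposet ?C (full_order S)"
    using Partial_order_full_order[of "Field A \<union> Field B"]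
    by (simp add: subposet_def full_order_mono)
  moreover have "connected_poset ?C"
    using connected_poset_union A' B x by metis
  moreover have "subposet A ?C"
    using A' by (auto simp: subposet_def full_order_def intro: FieldI1 FieldI2)
  ultimately have "?C = A"
    using A unfolding poset_component_def by blast
  moreover have "B \<subseteq> ?C"
    using B(2) by (auto simp: full_order_def intro: FieldI1 FieldI2)
  ultimately show ?thesis by simp
qed

lemma components_eq:
  assumes "poset_component A (full_order S)" "poset_component B (full_order S)"
    and "x \<in> Field A" "x \<in> Field B"
  shows "A = B"
proof
  show "A \<subseteq> B" "B \<subseteq> A"
    using assms component_absorbs by (meson poset_component_def subposet_def)+
qed

lemma component_comparable_closed:
  assumes A: "poset_component A (full_order S)" and x: "x \<in> Field A"
    and y: "y \<in> S" "x \<le> y \<or> y \<le> x"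
  shows "y \<in> Field A"
proof -
  have xS: "x \<in> S"
    using A x mono_Field[of A "full_order S"] by (auto simp: poset_component_def subposet_def)
  have "connected_poset (full_order {x, y})"
    using y(2) unfolding connected_poset_def Field_full_order
    by (auto intro: linked_if_le linked_sym)
  moreover have "full_order {x, y} \<subseteq> full_order S"
    using xS y by (intro full_order_mono) auto
  ultimately have "full_order {x, y} \<subseteq> A"
    using component_absorbs[OF A] x by simp
  from mono_Field[OF this] show ?thesis by simp
qed

lemma component_Field_subset: "poset_component A (full_order S) \<Longrightarrow> Field A \<subseteq> S"
  using mono_Field[of A "full_order S"] by (auto simp: poset_component_def subposet_def)

section \<open>Minima\<close>

lemma coordinate_less_d: "x \<in> Nd d \<Longrightarrow> y i < x i \<Longrightarrow> i < d"
  by (rule ccontr) (auto simp: Nd_def)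

lemma minima_antichain: "a \<in> minima Q \<Longrightarrow> b \<in> minima Q \<Longrightarrow> a \<le> b \<Longrightarrow> a = b"
  unfolding minima_def using order_le_less by blast

lemma nat_seq_nondecreasing_subseq:
  fixes s :: "nat \<Rightarrow> nat"
  obtains r :: "nat \<Rightarrow> nat" where "strict_mono r" "incseq (s \<circ> r)"
proof -
  obtain f where f: "strict_mono f" "monoseq (\<lambda>n. s (f n))"
    using seq_monosub by blast
  show ?thesis
  proof (cases "incseq (\<lambda>n. s (f n))")
    case True
    then show ?thesis using f that by (simp add: o_def)
  next
    case False
    then have dec: "decseq (\<lambda>n. s (f n))"
      using f(2) by (simp add: monoseq_iff)
    \<comment> \<open>A nonincreasing sequence of naturals is constant from the place of its least value on.\<close>
    obtain N where N: "\<And>n. s (f N) \<le> s (f n)"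
      using ex_has_least_nat[of "\<lambda>_. True" 0 "\<lambda>n. s (f n)"] by auto
    have "s (f (n + N)) = s (f N)" for n
      using N[of "n + N"] decseqD[OF dec, of N "n + N"] by simp
    then have "incseq (s \<circ> (\<lambda>n. f (n + N)))"
      by (simp add: incseq_def)
    moreover have "strict_mono (\<lambda>n. f (n + N))"
      using f(1) by (simp add: strict_mono_def)
    ultimately show ?thesis using that by blast
  qed
qed

text \<open>Dickson's lemma: refining an injective sequence coordinate by coordinate makes it
  nondecreasing in all coordinates, so an infinite subset of \<open>\<nat>\<^sup>d\<close> contains comparable points.\<close>

lemma finite_antichain_Nd:
  assumes sub: "A \<subseteq> Nd d" and anti: "\<And>a b. a \<in> A \<Longrightarrow> b \<in> A \<Longrightarrow> a \<le> b \<Longrightarrow> a = b"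
  shows "finite A"
proof (rule ccontr)
  assume "infinite A"
  then obtain x :: "nat \<Rightarrow> nat \<Rightarrow> nat" where x: "inj x" "range x \<subseteq> A"
    using infinite_countable_subset by blast
  have "\<exists>r. strict_mono r \<and> (\<forall>i<k. incseq (\<lambda>n. x (r n) i))" for k
  proof (induction k)
    case 0
    show ?case by (rule exI[of _ id]) (simp add: strict_mono_def)
  next
    case (Suc k)
    then obtain r where r: "strict_mono r" "\<And>i. i < k \<Longrightarrow> incseq (\<lambda>n. x (r n) i)"
      by blast
    obtain t where t: "strict_mono t" "incseq ((\<lambda>n. x (r n) k) \<circ> t)"
      using nat_seq_nondecreasing_subseq by blast
    have "incseq (\<lambda>n. x ((r \<circ> t) n) i)" if "i < Suc k" for i
    proof (cases "i = k")
      case True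
      then show ?thesis using t(2) by (simp add: o_def)
    next
      case False
      then have "incseq (\<lambda>n. x (r n) i)" using r(2) that by simp
      then show ?thesis
        using t(1) by (simp add: incseq_def strict_mono_less_eq)
    qed
    moreover have "strict_mono (r \<circ> t)"
      using r(1) t(1) by (rule strict_mono_o)
    ultimately show ?case by blast
  qed
  then obtain r where r: "strict_mono r" "\<And>i. i < d \<Longrightarrow> incseq (\<lambda>n. x (r n) i)"
    by blast
  have "x (r 0) i \<le> x (r 1) i" for i
  proof (cases "i < d")
    case True
    then show ?thesis using r(2) by (simp add: incseq_def)
  next
    case False
    moreover have "x (r 0) \<in> Nd d" using x(2) sub by auto
    ultimately show ?thesis by (simp add: Nd_def)
  qed
  then have "x (r 0) = x (r 1)"
    using x(2) by (intro anti) (auto simp: le_fun_def)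
  then show False
    using x(1) r(1) by (metis injD strict_mono_eq zero_neq_one)
qed

lemma finite_minima:
  assumes "Q \<subseteq> Nd d"
  shows "finite (minima Q)"
proof (rule finite_antichain_Nd)
  show "minima Q \<subseteq> Nd d" using assms by (auto simp: minima_def)
qed (rule minima_antichain)

lemma ex_minimum_le:
  assumes Q: "Q \<subseteq> Nd d" and q: "q \<in> Q"
  obtains m where "m \<in> minima Q" "m \<le> q"
proof -
  \<comment> \<open>The coordinate sum is strictly monotone on \<open>\<nat>\<^sup>d\<close>, so a point with least sum is minimal.\<close>
  let ?w = "\<lambda>p :: nat \<Rightarrow> nat. \<Sum>i<d. p i"
  obtain m where m: "m \<in> Q" "m \<le> q" and least: "\<And>p. p \<in> Q \<Longrightarrow> p \<le> q \<Longrightarrow> ?w m \<le> ?w p"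
    using ex_has_least_nat[of "\<lambda>p. p \<in> Q \<and> p \<le> q" q ?w] q by auto
  have "\<not> p < m" if p: "p \<in> Q" for p
  proof
    assume lt: "p < m"
    then obtain i where i: "p i < m i"
      by (auto simp: less_fun_def le_fun_def not_le)
    moreover have "i < d"
      using i m(1) Q coordinate_less_d by blast
    moreover have "p j \<le> m j" for j
      using lt by (simp add: less_fun_def le_fun_def)
    ultimately have "?w p < ?w m"
      by (intro sum_strict_mono_ex1) auto
    moreover have "p \<le> q" using lt m(2) by simp
    ultimately show False using least[OF p] by simp
  qed
  then show ?thesis using m that by (auto simp: minima_def)
qed

section \<open>Disconnected points of an interval\<close>

lemma interval_inD:
  assumes "interval_in d Q"
  shows "Q \<subseteq> Nd d" "Q \<noteq> {}"
    and "\<And>p q r. p \<in> Q \<Longrightarrow> r \<in> Q \<Longrightarrow> p \<le> q \<Longrightarrow> q \<le> r \<Longrightarrow> q \<in> Q"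
proof -
  show sub: "Q \<subseteq> Nd d" and "Q \<noteq> {}"
    using assms by (auto simp: interval_in_def connected_poset_def)
  fix p q r
  assume pr: "p \<in> Q" "r \<in> Q" "p \<le> q" "q \<le> r"
  have "q i = 0" if "i \<ge> d" for i
    using pr sub that le_funD[OF pr(4), of i] by (auto simp: Nd_def)
  then have "q \<in> Nd d" by (simp add: Nd_def)
  then show "q \<in> Q"
    using assms pr unfolding interval_in_def by blast
qed

lemma Field_dn [simp]: "Field (dn Q q) = {p \<in> Q. p < q}"
  by (simp add: dn_def)

lemma minima_subset_disconnected_points: "minima Q \<subseteq> disconnected_points Q"
proof
  fix m assume m: "m \<in> minima Q"
  then have "Field (dn Q m) = {}"
    by (auto simp: dn_def minima_def)
  then show "m \<in> disconnected_points Q"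
    using m by (simp add: disconnected_points_def connected_poset_def minima_def)
qed

text \<open>If two points lie below \<open>q\<close> and a common coordinate of theirs is smaller than that of \<open>q\<close>,
  then so is that coordinate of their join. Hence the join is not \<open>q\<close> itself.\<close>

lemma join_below:
  assumes Q: "interval_in d Q" and q: "q \<in> Q"
    and x: "x \<in> Q" "x \<le> q" "x i < q i" and y: "y \<le> q" "y i < q i"
  shows "sup x y \<in> Q" "sup x y < q"
proof -
  have le: "sup x y \<le> q" using x y by simp
  then show "sup x y \<in> Q"
    using interval_inD(3)[OF Q x(1) q] by simp
  have "sup x y i < q i" using x y by (simp add: sup_nat_def)
  then show "sup x y < q"
    using le by (metis less_irrefl order_le_less)
qed

lemma linked_below:
  assumes "interval_in d Q" "q \<in> Q" "x \<in> Q" "x < q" "x i < q i" "y \<in> Q" "y < q" "y i < q i"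
  shows "linked (dn Q q) x y"
  unfolding dn_def
  using assms join_below[of d Q q x i y]
  by (intro linked_if_common_upper_bound[of _ _ _ "sup x y"]) auto

lemma ex_unlinked_minima:
  assumes Q: "interval_in d Q" and q: "q \<in> disconnected_points Q" "q \<notin> minima Q"
  obtains x y where "x \<in> minima Q" "x < q" "y \<in> minima Q" "y < q" "\<not> linked (dn Q q) x y"
proof -
  have qQ: "q \<in> Q" using q by (simp add: disconnected_points_def)
  have "Field (dn Q q) \<noteq> {}"
    using q(2) qQ by (auto simp: minima_def)
  moreover have "\<not> connected_poset (dn Q q)"
    using q(1) by (simp add: disconnected_points_def)
  ultimately obtain u v where uv: "u \<in> Q" "u < q" "v \<in> Q" "v < q" "\<not> linked (dn Q q) u v"
    unfolding connected_poset_def Field_dn by blast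
  obtain x where x: "x \<in> minima Q" "x \<le> u"
    using ex_minimum_le interval_inD(1)[OF Q] uv(1) by blast
  obtain y where y: "y \<in> minima Q" "y \<le> v"
    using ex_minimum_le interval_inD(1)[OF Q] uv(3) by blast
  have xq: "x < q" and yq: "y < q" using x y uv by auto
  have "x \<in> Q" "y \<in> Q" using x y by (auto simp: minima_def)
  then have "linked (dn Q q) x u" "linked (dn Q q) y v"
    unfolding dn_def using x y uv xq yq by (auto intro!: linked_if_le)
  then have "\<not> linked (dn Q q) x y"
    using uv(5) linked_trans linked_sym by metis
  then show ?thesis using that x y xq yq by blast
qed

text \<open>Every disconnected point is the join of two minima: a minimum is its own join with itself,
  and two unlinked minima below \<open>q\<close> cannot have a join strictly below \<open>q\<close>.\<close>

lemma disconnected_points_subset_joins: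
  assumes Q: "interval_in d Q"
  shows "disconnected_points Q \<subseteq> (\<lambda>(x, y). sup x y) ` (minima Q \<times> minima Q)"
proof
  fix q assume q: "q \<in> disconnected_points Q"
  show "q \<in> (\<lambda>(x, y). sup x y) ` (minima Q \<times> minima Q)"
  proof (cases "q \<in> minima Q")
    case True
    then show ?thesis by (intro image_eqI[of _ _ "(q, q)"]) auto
  next
    case False
    have qQ: "q \<in> Q" using q by (simp add: disconnected_points_def)
    obtain x y where xy: "x \<in> minima Q" "x < q" "y \<in> minima Q" "y < q"
      and un: "\<not> linked (dn Q q) x y"
      using ex_unlinked_minima[OF Q q False] .
    have in_Q: "x \<in> Q" "y \<in> Q" using xy by (auto simp: minima_def)
    have "q i \<le> sup x y i" for i
    proof (rule ccontr)
      assume "\<not> q i \<le> sup x y i"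
      then have "x i < q i" "y i < q i" by (auto simp: sup_nat_def)
      then show False using linked_below[OF Q qQ] xy in_Q un by blast
    qed
    then have "q = sup x y"
      using xy by (intro antisym) (auto simp: le_fun_def[of q])
    then show ?thesis using xy by (intro image_eqI[of _ _ "(x, y)"]) auto
  qed
qed

lemma finite_disconnected_points:
  assumes "interval_in d Q"
  shows "finite (disconnected_points Q)"
  using disconnected_points_subset_joins[OF assms] finite_minima[OF interval_inD(1)[OF assms]]
  by (meson finite_SigmaI finite_imageI finite_subset)

lemma card_disconnected_points_le_square:
  assumes "interval_in d Q"
  shows "card (disconnected_points Q) \<le> (card (minima Q))\<^sup>2"
proof -
  have fin: "finite (minima Q \<times> minima Q)"
    using finite_minima[OF interval_inD(1)[OF assms]] by simp
  have "card (disconnected_points Q) \<le> card (minima Q \<times> minima Q)"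
    using surj_card_le[OF fin disconnected_points_subset_joins[OF assms]] .
  then show ?thesis by (simp add: card_cartesian_product power2_eq_square)
qed

section \<open>At most three coordinates\<close>

text \<open>All points below \<open>q\<close> that drop in coordinate \<open>i\<close> lie on one line through \<open>q\<close> in direction \<open>i\<close>,
  and \<open>m\<close> is a minimum among them. The second minimum \<open>m'\<close> on the level of \<open>q\<close> marks where this line
  has to stop.\<close>

definition isolated_drop :: "(nat \<Rightarrow> nat) set \<Rightarrow> (nat \<Rightarrow> nat) \<Rightarrow> (nat \<Rightarrow> nat) \<Rightarrow> nat \<Rightarrow> bool" where
  "isolated_drop Q q m i \<longleftrightarrow> m \<in> minima Q \<and> m < q \<and> m i < q i \<and>
     (\<exists>m'\<in>minima Q. m' \<le> q \<and> m' i = q i) \<and>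
     (\<forall>z\<in>Q. z < q \<longrightarrow> z i < q i \<longrightarrow> (\<forall>j. j \<noteq> i \<longrightarrow> z j = q j))"

text \<open>Two unlinked minima \<open>x\<close>, \<open>y\<close> below \<open>q\<close> drop below \<open>q\<close> in disjoint sets of coordinates; pick
  \<open>i\<close> for \<open>x\<close> and \<open>j\<close> for \<open>y\<close>. At most one further coordinate \<open>k\<close> remains. A point that drops in \<open>i\<close> and
  \<open>k\<close> together with one that drops in \<open>j\<close> and \<open>k\<close> would link \<open>x\<close> to \<open>y\<close>. Hence one of \<open>i\<close>, \<open>j\<close> is
  isolated: whatever drops there drops nowhere else.\<close>

lemma ex_isolated_drop:
  assumes Q: "interval_in d Q" and d: "d \<le> 3"
    and q: "q \<in> disconnected_points Q" "q \<notin> minima Q"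
  obtains m i where "i < d" "isolated_drop Q q m i"
proof -
  have qQ: "q \<in> Q" using q by (simp add: disconnected_points_def)
  note sub = interval_inD(1)[OF Q]
  obtain x y where xy: "x \<in> minima Q" "x < q" "y \<in> minima Q" "y < q"
    and un: "\<not> linked (dn Q q) x y"
    using ex_unlinked_minima[OF Q q] .
  have in_Q: "x \<in> Q" "y \<in> Q" using xy by (auto simp: minima_def)
  have drop: "\<exists>i<d. z i < q i" if z: "z < q" for z
  proof -
    obtain i where i: "z i < q i"
      using z by (auto simp: less_fun_def le_fun_def not_le)
    then have "i < d" using qQ sub coordinate_less_d by blast
    then show ?thesis using i by blast
  qed
  have ge: "z k = q k" if "z < q" "\<not> z k < q k" for z k
    using that by (metis le_funD le_neq_implies_less less_imp_le)
  obtain i where i: "i < d" "x i < q i" using drop xy by blast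
  obtain j where j: "j < d" "y j < q j" using drop xy by blast
  have lx: "linked (dn Q q) x z" if "z \<in> Q" "z < q" "z i < q i" for z
    using linked_below[OF Q qQ] that xy in_Q i by blast
  have ly: "linked (dn Q q) y z" if "z \<in> Q" "z < q" "z j < q j" for z
    using linked_below[OF Q qQ] that xy in_Q j by blast
  have no_ij: "\<not> (z i < q i \<and> z j < q j)" if "z \<in> Q" "z < q" for z
    using lx ly un that linked_trans linked_sym by metis
  have third: "k = l" if "k \<noteq> i" "k \<noteq> j" "l \<noteq> i" "l \<noteq> j" "k < d" "l < d" for k l
    using that d i j no_ij[OF in_Q(1) xy(2)] by (cases "i = j") (use i j no_ij in_Q xy in auto)
  have lt_d: "k < d" if "z k < q k" for z k
    using that qQ sub coordinate_less_d by blast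
  have "(\<forall>z\<in>Q. z < q \<longrightarrow> z i < q i \<longrightarrow> (\<forall>k. k \<noteq> i \<longrightarrow> z k = q k)) \<or>
        (\<forall>z\<in>Q. z < q \<longrightarrow> z j < q j \<longrightarrow> (\<forall>k. k \<noteq> j \<longrightarrow> z k = q k))"
  proof (rule ccontr)
    assume "\<not> ?thesis"
    then obtain z k w l where z: "z \<in> Q" "z < q" "z i < q i" "k \<noteq> i" "z k < q k"
      and w: "w \<in> Q" "w < q" "w j < q j" "l \<noteq> j" "w l < q l"
      using ge by metis
    have "k \<noteq> j" "l \<noteq> i" using no_ij z w by blast+
    then have "k = l" using third lt_d z w by metis
    then have "linked (dn Q q) z w"
      using linked_below[OF Q qQ] z w by blast
    then show False
      using lx[OF z(1-3)] ly[OF w(1-3)] un linked_trans linked_sym by metis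
  qed
  then show ?thesis
  proof
    assume iso: "\<forall>z\<in>Q. z < q \<longrightarrow> z i < q i \<longrightarrow> (\<forall>k. k \<noteq> i \<longrightarrow> z k = q k)"
    have "y i = q i" using lx[OF in_Q(2) xy(4)] un ge[OF xy(4)] by blast
    then have "isolated_drop Q q x i"
      unfolding isolated_drop_def using iso xy(1-3) i(2) less_imp_le[OF xy(4)] by blast
    then show ?thesis using that i(1) by blast
  next
    assume iso: "\<forall>z\<in>Q. z < q \<longrightarrow> z j < q j \<longrightarrow> (\<forall>k. k \<noteq> j \<longrightarrow> z k = q k)"
    have "x j = q j" using ly[OF in_Q(1) xy(2)] un linked_sym[of y x] ge[OF xy(2)] by blast
    then have "isolated_drop Q q y j"
      unfolding isolated_drop_def using iso xy(1,3,4) j(2) less_imp_le[OF xy(2)] by blast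
    then show ?thesis using that j(1) by blast
  qed
qed

text \<open>If \<open>q'\<close> were a point with the same \<open>m\<close> and \<open>i\<close> further along the line, then the second minimum
  \<open>m'\<close> that \<open>q\<close> dominates would drop in coordinate \<open>i\<close> below \<open>q'\<close>, hence agree with \<open>q'\<close>, and so with
  \<open>m\<close>, in all other coordinates. But two distinct minima are not comparable.\<close>

lemma isolated_drop_unique:
  assumes q: "isolated_drop Q q m i" and q': "isolated_drop Q q' m i"
  shows "q = q'"
proof -
  have off: "m j = q j" if "j \<noteq> i" "isolated_drop Q q m i" for q j
    using that unfolding isolated_drop_def minima_def by blast
  have not_less: "\<not> q i < q' i" if q: "isolated_drop Q q m i" and q': "isolated_drop Q q' m i" for q q'
  proof
    assume lt: "q i < q' i"
    have m: "m \<in> minima Q" "m i < q i"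
      using q by (simp_all add: isolated_drop_def)
    obtain m' where m': "m' \<in> minima Q" "m' \<le> q" "m' i = q i"
      using q unfolding isolated_drop_def by blast
    have "q j \<le> q' j" for j
      using lt off[OF _ q, of j] off[OF _ q', of j] by (cases "j = i") auto
    then have "m' \<le> q'"
      using m'(2) by (meson le_funI order_trans)
    moreover have m'_lt: "m' i < q' i" using lt m'(3) by simp
    ultimately have "m' < q'"
      by (auto simp: less_le)
    moreover have "m' \<in> Q" using m'(1) by (simp add: minima_def)
    ultimately have "m' j = q' j" if "j \<noteq> i" for j
      using q' m'_lt that unfolding isolated_drop_def by blast
    then have "m j \<le> m' j" for j
      using off[OF _ q', of j] m(2) m'(3) by (cases "j = i") auto
    then have "m = m'"
      using minima_antichain[OF m(1) m'(1)] by (simp add: le_fun_def)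
    then show False using m(2) m'(3) by simp
  qed
  show ?thesis
  proof
    fix j
    show "q j = q' j"
      using off[OF _ q, of j] off[OF _ q', of j] not_less[OF q q'] not_less[OF q' q]
      by (cases "j = i") auto
  qed
qed

lemma card_disconnected_points_le_linear:
  assumes Q: "interval_in d Q" and d: "d \<le> 3"
  shows "card (disconnected_points Q) \<le> (d + 1) * card (minima Q)"
proof -
  let ?D = "disconnected_points Q - minima Q"
  have fin: "finite (minima Q)"
    using finite_minima[OF interval_inD(1)[OF Q]] .
  have "card ?D \<le> card (minima Q \<times> {..<d})"
  proof (rule card_le_if_inj_on_rel[where r = "\<lambda>q b. isolated_drop Q q (fst b) (snd b)"])
    show "finite (minima Q \<times> {..<d})" using fin by simp
  next
    fix q assume "q \<in> ?D"
    then obtain m i where mi: "i < d" "isolated_drop Q q m i"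
      using ex_isolated_drop[OF Q d] by blast
    then have "m \<in> minima Q" by (simp add: isolated_drop_def)
    then show "\<exists>b. b \<in> minima Q \<times> {..<d} \<and> isolated_drop Q q (fst b) (snd b)"
      using mi by (intro exI[of _ "(m, i)"]) simp
  qed (rule isolated_drop_unique)
  then have D: "card ?D \<le> card (minima Q) * d"
    by (simp add: card_cartesian_product)
  have "card (disconnected_points Q) = card ?D + card (minima Q)"
    using card_mono[OF finite_disconnected_points[OF Q] minima_subset_disconnected_points]
    by (simp add: card_Diff_subset[OF fin minima_subset_disconnected_points])
  then show ?thesis using D by (simp add: algebra_simps)
qed

section \<open>The size of a scaffold in terms of its elements\<close>

lemma initial_scaffoldD:
  assumes "initial_scaffold P Q"
  shows "Partial_order P" "P \<subseteq> full_order Q" "Field P = disconnected_points Q"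
  using assms by (auto simp: initial_scaffold_def subposet_def)

lemma finite_scaffold:
  assumes "interval_in d Q" "initial_scaffold P Q"
  shows "finite P"
proof -
  have "P \<subseteq> Field P \<times> Field P" by (auto intro: FieldI1 FieldI2)
  then show ?thesis
    using finite_disconnected_points[OF assms(1)] initial_scaffoldD(3)[OF assms(2)]
    by (metis finite_SigmaI finite_subset)
qed

lemma card_disconnected_points_le_scaffold:
  assumes "interval_in d Q" and P: "initial_scaffold P Q"
  shows "card (disconnected_points Q) \<le> card P"
proof -
  have "refl_on (Field P) P"
    using initial_scaffoldD(1)[OF P] by (simp add: partial_order_on_def preorder_on_def)
  then have "(\<lambda>p. (p, p)) ` disconnected_points Q \<subseteq> P"
    using initial_scaffoldD(3)[OF P] by (auto dest: refl_onD)
  from card_mono[OF finite_scaffold[OF assms] this] show ?thesis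
    by (simp add: card_image inj_on_def)
qed

text \<open>The nonidentity relations \<open>m < p\<close> over a fixed \<open>p\<close> belong to different components of the points
  below \<open>p\<close>. Two of them cannot drop below \<open>p\<close> in the same coordinate, because their join would
  connect the components. So there are at most \<open>d\<close> of them.\<close>

lemma card_scaffold_le:
  assumes Q: "interval_in d Q" and P: "initial_scaffold P Q"
  shows "card P \<le> (d + 1) * card (disconnected_points Q)"
proof -
  have PE: "\<exists>A. poset_component A (dn Q p) \<and> m \<in> Field A \<and> m \<in> minima Q \<and>
      {m' \<in> Field A. (m', p) \<in> P} = {m}" if mp: "(m, p) \<in> P" "m \<noteq> p" for m p
  proof -
    obtain A where A: "poset_component A (dn Q p)" "m \<in> Field A"
      using P mp by (fastforce simp: initial_scaffold_def)
    moreover have "p \<in> Field P" using mp by (rule_tac FieldI2)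
    ultimately obtain m0 where "m0 \<in> minima Q" "{m' \<in> Field A. (m', p) \<in> P} = {m0}"
      using P unfolding initial_scaffold_def by blast
    moreover from this have "m = m0" using A mp by blast
    ultimately show ?thesis using A by blast
  qed
  have lt: "m \<in> Q \<and> p \<in> Q \<and> m < p" if "(m, p) \<in> P" "m \<noteq> p" for m p
    using initial_scaffoldD(2)[OF P] that by (auto simp: full_order_def)
  have inj: "m = m'" if m: "(m, p) \<in> P" "m \<noteq> p" "m i < p i" and m': "(m', p) \<in> P" "m' \<noteq> p" "m' i < p i"
    for m m' p i
  proof -
    obtain A where A: "poset_component A (dn Q p)" "m \<in> Field A" "{u \<in> Field A. (u, p) \<in> P} = {m}"
      using PE m by blast
    note lts = lt[OF m(1,2)] lt[OF m'(1,2)]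
    have sup: "sup m m' \<in> Q" "sup m m' < p"
      using join_below[OF Q, of p m i m'] lts m m' by auto
    have "sup m m' \<in> Field A"
      using component_comparable_closed[OF A(1)[unfolded dn_def] A(2), of "sup m m'"] sup by simp
    then have "m' \<in> Field A"
      using component_comparable_closed[OF A(1)[unfolded dn_def], of "sup m m'" m'] lts by simp
    then have "m' \<in> {u \<in> Field A. (u, p) \<in> P}" using m'(1) by simp
    then show ?thesis unfolding A(3) by simp
  qed
  \<comment> \<open>A relation \<open>m < p\<close> is charged to a coordinate in which \<open>m\<close> drops, an identity to the
    additional label \<open>d\<close>.\<close>
  have "card P \<le> card (disconnected_points Q \<times> {..d})"
  proof (rule card_le_if_inj_on_rel[where
        r = "\<lambda>(m, p) (p', i). p = p' \<and> (if m = p then i = d else i < d \<and> m i < p i)"])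
    show "finite (disconnected_points Q \<times> {..d})"
      using finite_disconnected_points[OF Q] by simp
  next
    fix a assume "a \<in> P"
    then obtain m p where a: "a = (m, p)" "(m, p) \<in> P" by (cases a) auto
    have p: "p \<in> disconnected_points Q"
      using a initial_scaffoldD(3)[OF P] by (metis FieldI2)
    show "\<exists>b. b \<in> disconnected_points Q \<times> {..d} \<and>
      (case a of (m, p) \<Rightarrow> \<lambda>(p', i). p = p' \<and> (if m = p then i = d else i < d \<and> m i < p i)) b"
    proof (cases "m = p")
      case True
      then show ?thesis using a p by (intro exI[of _ "(p, d)"]) simp
    next
      case False
      have mp: "p \<in> Q" "m < p" using lt a False by auto
      then obtain i where i: "m i < p i"
        by (auto simp: less_fun_def le_fun_def not_le)
      then have "i < d"
        using mp interval_inD(1)[OF Q] coordinate_less_d by blast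
      then show ?thesis using a p i False by (intro exI[of _ "(p, i)"]) simp
    qed
  next
    fix a a' b
    assume "a \<in> P" "a' \<in> P"
      "(case a of (m, p) \<Rightarrow> \<lambda>(p', i). p = p' \<and> (if m = p then i = d else i < d \<and> m i < p i)) b"
      "(case a' of (m, p) \<Rightarrow> \<lambda>(p', i). p = p' \<and> (if m = p then i = d else i < d \<and> m i < p i)) b"
    then show "a = a'"
      using inj by (auto split: prod.splits if_splits)
  qed
  then show ?thesis by (simp add: card_cartesian_product mult.commute)
qed

section \<open>Existence of scaffolds\<close>

text \<open>One minimum is chosen in every component; a component is closed under comparability, so it
  contains a minimum of the interval. Transitivity is no obstacle because the lower end of a
  nonidentity relation is minimal, so that two such relations never compose.\<close>

lemma ex_initial_scaffold:
  assumes Q: "interval_in d Q"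
  shows "\<exists>P. initial_scaffold P Q"
proof -
  let ?D = "disconnected_points Q"
  have "\<exists>m. m \<in> Field A \<and> m \<in> minima Q" if A: "poset_component A (dn Q p)" for A p
  proof -
    obtain x where x: "x \<in> Field A"
      using A by (auto simp: poset_component_def connected_poset_def)
    then have "x \<in> Q" "x < p"
      using component_Field_subset[OF A[unfolded dn_def]] by auto
    then obtain m where m: "m \<in> minima Q" "m \<le> x"
      using ex_minimum_le interval_inD(1)[OF Q] by blast
    then have "m \<in> Field A"
      using component_comparable_closed[OF A[unfolded dn_def] x, of m] \<open>x < p\<close>
      by (auto simp: minima_def)
    then show ?thesis using m by blast
  qed
  then obtain f where f: "\<And>A p. poset_component A (dn Q p) \<Longrightarrow> f A \<in> Field A \<and> f A \<in> minima Q"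
    by metis
  define P where "P = {(p, p) |p. p \<in> ?D} \<union> {(f A, p) |A p. p \<in> ?D \<and> poset_component A (dn Q p)}"
  have below: "x \<in> Q" "x < p" if "poset_component A (dn Q p)" "x \<in> Field A" for A p x
    using component_Field_subset[of A "{u \<in> Q. u < p}"] that by (auto simp: dn_def)
  have P_cases: "p \<in> ?D \<and> (m = p \<or> m \<in> minima Q \<and> m < p)" if "(m, p) \<in> P" for m p
    using that f below by (fastforce simp: P_def)
  have D_sub: "?D \<subseteq> Q" by (auto simp: disconnected_points_def)
  have sub: "P \<subseteq> full_order Q"
    using P_cases D_sub by (force simp: full_order_def minima_def)
  have field: "Field P = ?D"
  proof
    show "Field P \<subseteq> ?D"
      using P_cases minima_subset_disconnected_points[of Q] by (force simp: Field_def)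
    show "?D \<subseteq> Field P" by (auto simp: P_def Field_def)
  qed
  have "trans P"
  proof (rule transI)
    fix x y z assume xyz: "(x, y) \<in> P" "(y, z) \<in> P"
    have "x = y \<or> y = z"
      using P_cases[OF xyz(1)] P_cases[OF xyz(2)] unfolding minima_def by blast
    then show "(x, z) \<in> P" using xyz by blast
  qed
  moreover have "antisym P"
    using antisym_subset[OF sub] Partial_order_full_order[of Q]
    by (simp add: partial_order_on_def)
  moreover have "refl_on (Field P) P"
    using field by (auto simp: refl_on_def P_def)
  ultimately have "Partial_order P"
    by (auto simp: partial_order_on_def preorder_on_def intro: FieldI1 FieldI2)
  moreover have "{m' \<in> Field A. (m', p) \<in> P} = {f A}" if p: "p \<in> ?D" and A: "poset_component A (dn Q p)"
    for p A
  proof -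
    have "m' = f A" if m': "m' \<in> Field A" "(m', p) \<in> P" for m'
    proof -
      have "m' \<noteq> p" using below[OF A m'(1)] by auto
      then obtain B where B: "m' = f B" "poset_component B (dn Q p)"
        using m'(2) by (auto simp: P_def)
      then have "A = B"
        using components_eq[of A "{u \<in> Q. u < p}" B m'] A m'(1) f by (auto simp: dn_def)
      then show ?thesis using B by simp
    qed
    then show ?thesis using f[OF A] A p by (auto simp: P_def)
  qed
  moreover have "\<exists>A. poset_component A (dn Q p) \<and> m \<in> Field A" if "(m, p) \<in> P" "m \<noteq> p" for m p
    using that f by (auto simp: P_def)
  ultimately have "initial_scaffold P Q"
    unfolding initial_scaffold_def subposet_def using sub field f by blast
  then show ?thesis ..
qed

section \<open>Quadratically many disconnected points in four coordinates\<close>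

lemma interval_in_upset:
  assumes M: "M \<subseteq> Nd d" "M \<noteq> {}"
  shows "interval_in d {x \<in> Nd d. \<exists>m\<in>M. m \<le> x}" (is "interval_in d ?Q")
proof -
  have "linked (full_order ?Q) x y" if "x \<in> ?Q" "y \<in> ?Q" for x y
  proof (rule linked_if_common_upper_bound[OF that, of "sup x y"])
    show "sup x y \<in> ?Q" using that by (auto simp: Nd_def intro: le_supI1)
  qed auto
  moreover have "?Q \<noteq> {}" using M by blast
  ultimately show ?thesis
    unfolding interval_in_def connected_poset_def Field_full_order by (blast intro: order_trans)
qed

lemma minima_upset:
  assumes M: "M \<subseteq> Nd d" and anti: "\<And>a b. a \<in> M \<Longrightarrow> b \<in> M \<Longrightarrow> a \<le> b \<Longrightarrow> a = b"
  shows "minima {x \<in> Nd d. \<exists>m\<in>M. m \<le> x} = M" (is "minima ?Q = M")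
proof
  show "minima ?Q \<subseteq> M"
    using M by (force simp: minima_def order_le_less)
  show "M \<subseteq> minima ?Q"
  proof
    fix m assume m: "m \<in> M"
    have "\<not> p < m" if p: "p \<in> ?Q" for p
    proof
      assume "p < m"
      moreover obtain m' where m': "m' \<in> M" "m' \<le> p" using p by blast
      ultimately have "m' < m" by (meson order_le_less_trans)
      then show False using anti[OF m'(1) m] by (auto simp: less_le)
    qed
    then show "m \<in> minima ?Q" using m M by (auto simp: minima_def)
  qed
qed

text \<open>If only two generators lie below their join \<open>q\<close>, every point below \<open>q\<close> dominates exactly one of
  them, and comparable points dominate the same one.\<close>

lemma join_disconnected:
  assumes M: "M \<subseteq> Nd d" and a: "a \<in> M" "\<not> b \<le> a" and b: "b \<in> M" "\<not> a \<le> b"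
    and only: "\<And>m. m \<in> M \<Longrightarrow> m \<le> sup a b \<Longrightarrow> m = a \<or> m = b"
  shows "sup a b \<in> disconnected_points {x \<in> Nd d. \<exists>m\<in>M. m \<le> x}" (is "_ \<in> disconnected_points ?Q")
proof -
  have lt: "a < sup a b" "b < sup a b"
    using a b by (auto simp: less_le_not_le)
  have Nd: "a \<in> Nd d" "b \<in> Nd d" using a b M by auto
  have "sup a b \<in> ?Q" using a Nd by (auto simp: Nd_def intro!: bexI[of _ a])
  moreover have "\<not> connected_poset (dn ?Q (sup a b))"
  proof
    assume conn: "connected_poset (dn ?Q (sup a b))"
    have "a \<le> a \<longleftrightarrow> a \<le> b"
    proof (rule connected_poset_invariant[OF conn, where \<Phi> = "\<lambda>p. a \<le> p"])
      show "a \<in> Field (dn ?Q (sup a b))" "b \<in> Field (dn ?Q (sup a b))"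
        using a b lt Nd by (auto simp: dn_def)
    next
      fix u v assume "(u, v) \<in> dn ?Q (sup a b)"
      then have uv: "u \<in> ?Q" "u < sup a b" "v < sup a b" "u \<le> v"
        by (auto simp: dn_def full_order_def)
      then obtain m where "m \<in> M" "m \<le> u" by blast
      then have "a \<le> u \<or> b \<le> u"
        using only[of m] order_trans[OF _ less_imp_le[OF uv(2)], of m] by blast
      moreover have "\<not> (a \<le> v \<and> b \<le> v)"
        using uv(3) by (auto simp: less_le_not_le)
      ultimately show "a \<le> u \<longleftrightarrow> a \<le> v"
        using uv(4) order_trans by blast
    qed
    then show False using b by simp
  qed
  ultimately show ?thesis by (simp add: disconnected_points_def)
qed

text \<open>Two antichains in complementary coordinate planes: among the points \<open>(i, n - i, 0, 0)\<close> and
  \<open>(0, 0, j, n - j)\<close>, only the two that form the join \<open>(i, n - i, j, n - j)\<close> lie below it. So each of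
  the quadratically many mixed pairs contributes a disconnected point of its own.\<close>

lemma ex_interval_many_disconnected_points:
  assumes d: "d > 3" and n: "n \<ge> 2"
  shows "\<exists>Q. interval_in d Q \<and> card (minima Q) = n \<and>
    (n div 2) * (n - n div 2) \<le> card (disconnected_points Q)"
proof -
  define a :: "nat \<Rightarrow> nat \<Rightarrow> nat" where "a i = (\<lambda>_. 0)(0 := i, 1 := n - i)" for i
  define b :: "nat \<Rightarrow> nat \<Rightarrow> nat" where "b j = (\<lambda>_. 0)(2 := j, 3 := n - j)" for j
  let ?I = "{..<n div 2}" and ?J = "{..<n - n div 2}"
  define M where "M = a ` ?I \<union> b ` ?J"
  let ?Q = "{x \<in> Nd d. \<exists>m\<in>M. m \<le> x}"
  have I: "i < n" if "i \<in> ?I" for i using that by simp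
  have J: "j < n" if "j \<in> ?J" for j using that by simp
  have a_vals: "a i 0 = i" "a i (Suc 0) = n - i" "a i 2 = 0" "a i 3 = 0" for i
    by (simp_all add: a_def)
  have b_vals: "b j 0 = 0" "b j (Suc 0) = 0" "b j 2 = j" "b j 3 = n - j" for j
    by (simp_all add: b_def)
  have a_eq: "i = i'" if "a i \<le> sup (a i') (b j)" "i < n" "i' < n" for i i' j
    using le_funD[OF that(1), of 0] le_funD[OF that(1), of 1] that(2,3)
    by (simp add: a_vals b_vals sup_nat_def)
  have b_eq: "j = j'" if "b j \<le> sup (a i) (b j')" "j < n" "j' < n" for i j j'
    using le_funD[OF that(1), of 2] le_funD[OF that(1), of 3] that(2,3)
    by (simp add: a_vals b_vals sup_nat_def)
  have ab: "\<not> a i \<le> b j" if "i < n" for i j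
    using that le_funD[of "a i" "b j" 1] by (auto simp: a_vals b_vals)
  have ba: "\<not> b j \<le> a i" if "j < n" for i j
    using that le_funD[of "b j" "a i" 3] by (auto simp: a_vals b_vals)
  have M: "M \<subseteq> Nd d"
    using d by (auto simp: M_def Nd_def a_def b_def)
  have "a 0 \<in> M" using n by (auto simp: M_def)
  then have ne: "M \<noteq> {}" by blast
  have anti: "x = y" if "x \<in> M" "y \<in> M" "x \<le> y" for x y
    using that a_eq b_eq ab ba I J unfolding M_def by (fastforce intro: le_supI1 le_supI2)
  have card_M: "card M = n"
  proof -
    have "inj_on a ?I" "inj_on b ?J"
      by (auto intro!: inj_onI dest: fun_cong[of _ _ 0] fun_cong[of _ _ 2] simp: a_def b_def)
    moreover have "a ` ?I \<inter> b ` ?J = {}"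
      using ab I by fastforce
    ultimately show ?thesis
      using n by (simp add: M_def card_Un_disjoint card_image)
  qed
  let ?q = "\<lambda>(i, j). sup (a i) (b j)"
  have disc: "sup (a i) (b j) \<in> disconnected_points ?Q" if ij: "i \<in> ?I" "j \<in> ?J" for i j
  proof (rule join_disconnected[OF M])
    show "a i \<in> M" "b j \<in> M" using ij by (auto simp: M_def)
    show "\<not> b j \<le> a i" "\<not> a i \<le> b j" using ab ba I J ij by blast+
    show "m = a i \<or> m = b j" if "m \<in> M" "m \<le> sup (a i) (b j)" for m
      using that a_eq b_eq I J ij unfolding M_def by blast
  qed
  have image: "?q ` (?I \<times> ?J) \<subseteq> disconnected_points ?Q"
  proof (rule image_subsetI)
    fix z assume "z \<in> ?I \<times> ?J"
    then show "?q z \<in> disconnected_points ?Q"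
      using disc[of "fst z" "snd z"] by (simp add: mem_Times_iff split_beta)
  qed
  have inj: "inj_on ?q (?I \<times> ?J)"
  proof (rule inj_onI)
    fix z z' assume "?q z = ?q z'"
    then have eq: "sup (a (fst z)) (b (snd z)) = sup (a (fst z')) (b (snd z'))"
      by (simp add: split_beta)
    show "z = z'"
      using fun_cong[OF eq, of 0] fun_cong[OF eq, of 2]
      by (simp add: a_vals b_vals sup_nat_def prod_eq_iff)
  qed
  have int: "interval_in d ?Q"
    using interval_in_upset[OF M ne] .
  have "card (?I \<times> ?J) \<le> card (disconnected_points ?Q)"
    using card_mono[OF finite_disconnected_points[OF int] image] unfolding card_image[OF inj] .
  moreover have "minima ?Q = M"
    using minima_upset[OF M anti] .
  ultimately show ?thesis
    using int card_M by (intro exI[of _ ?Q]) (simp add: card_cartesian_product)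
qed

section \<open>Asymptotic size of scaffolds\<close>

lemma card_scaffold_le_square:
  assumes "interval_in d Q" "initial_scaffold P Q"
  shows "card P \<le> (d + 1) * (card (minima Q))\<^sup>2"
  using card_scaffold_le[OF assms] card_disconnected_points_le_square[OF assms(1)]
  by (meson mult_le_mono2 order_trans)

lemma card_scaffold_le_linear:
  assumes "interval_in d Q" "initial_scaffold P Q" "d \<le> 3"
  shows "card P \<le> (d + 1)\<^sup>2 * card (minima Q)"
proof -
  have "card P \<le> (d + 1) * ((d + 1) * card (minima Q))"
    using card_scaffold_le[OF assms(1,2)] card_disconnected_points_le_linear[OF assms(1,3)]
    by (meson mult_le_mono2 order_trans)
  then show ?thesis by (simp only: power2_eq_square mult.assoc)
qed

lemma card_minima_le_scaffold:
  assumes "interval_in d Q" "initial_scaffold P Q"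
  shows "card (minima Q) \<le> card P"
  using card_mono[OF finite_disconnected_points[OF assms(1)] minima_subset_disconnected_points]
    card_disconnected_points_le_scaffold[OF assms] by simp

lemma max_scaffold_size_bounds:
  assumes d: "d > 3" and n: "n \<ge> 2"
  shows "(n div 2) * (n - n div 2) \<le> max_scaffold_size d n"
    and "max_scaffold_size d n \<le> (d + 1) * n\<^sup>2"
proof -
  let ?S = "{card P |P Q. interval_in d Q \<and> card (minima Q) = n \<and> initial_scaffold P Q}"
  have bound: "\<forall>s\<in>?S. s \<le> (d + 1) * n\<^sup>2"
    using card_scaffold_le_square by blast
  then have fin: "finite ?S"
    by (meson finite_nat_set_iff_bounded_le)
  obtain Q where Q: "interval_in d Q" "card (minima Q) = n"
    "(n div 2) * (n - n div 2) \<le> card (disconnected_points Q)"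
    using ex_interval_many_disconnected_points[OF d n] by blast
  obtain P where P: "initial_scaffold P Q"
    using ex_initial_scaffold[OF Q(1)] ..
  have mem: "card P \<in> ?S" using P Q by blast
  show "(n div 2) * (n - n div 2) \<le> max_scaffold_size d n"
    using Q(3) card_disconnected_points_le_scaffold[OF Q(1) P] Max_ge[OF fin mem]
    unfolding max_scaffold_size_def by linarith
  show "max_scaffold_size d n \<le> (d + 1) * n\<^sup>2"
    unfolding max_scaffold_size_def using Max_in[OF fin] mem bound by blast
qed

lemma max_scaffold_size_bigtheta:
  assumes d: "d > 3"
  shows "(\<lambda>n. real (max_scaffold_size d n)) \<in> \<Theta>(\<lambda>n. (real n)\<^sup>2)"
proof (rule bigthetaI)
  have "real (max_scaffold_size d n) \<le> real (d + 1) * (real n)\<^sup>2" if "n \<ge> 2" for n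
    using max_scaffold_size_bounds(2)[OF d that]
    by (metis of_nat_le_iff of_nat_mult of_nat_power)
  then show "(\<lambda>n. real (max_scaffold_size d n)) \<in> O(\<lambda>n. (real n)\<^sup>2)"
    by (intro bigoI[of _ "real (d + 1)"] eventually_at_top_linorderI[of 2]) auto
  have "1 / 8 * (real n)\<^sup>2 \<le> real (max_scaffold_size d n)" if n: "n \<ge> 2" for n
  proof -
    have "n \<le> 4 * (n div 2)" "n \<le> 2 * (n - n div 2)" using n by linarith+
    then have "n * n \<le> (4 * (n div 2)) * (2 * (n - n div 2))"
      by (rule mult_le_mono)
    also have "\<dots> = 8 * ((n div 2) * (n - n div 2))" by simp
    also have "\<dots> \<le> 8 * max_scaffold_size d n"
      using max_scaffold_size_bounds(1)[OF d n] by simp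
    finally have "real (n * n) \<le> real (8 * max_scaffold_size d n)"
      by (simp only: of_nat_le_iff)
    then show ?thesis by (simp add: power2_eq_square)
  qed
  then show "(\<lambda>n. real (max_scaffold_size d n)) \<in> \<Omega>(\<lambda>n. (real n)\<^sup>2)"
    by (intro landau_omega.bigI[of "1 / 8"] eventually_at_top_linorderI[of 2]) auto
qed

theorem theorem3p10:
  fixes d :: nat
  assumes "d \<ge> 1"
  shows "(d \<le> 3 \<longrightarrow>
            (\<exists>c C :: real. c > 0 \<and> C > 0 \<and>
               (\<forall>Q P n. interval_in d Q \<and> card (minima Q) = n \<and> initial_scaffold P Q \<longrightarrow>
                  finite P \<and> c * real n \<le> real (card P) \<and> real (card P) \<le> C * real n))) \<and>
         (d > 3 \<longrightarrow>
            (\<exists>C :: real. C > 0 \<and>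
               (\<forall>Q P n. interval_in d Q \<and> card (minima Q) = n \<and> initial_scaffold P Q \<longrightarrow>
                  finite P \<and> real (card P) \<le> C * (real n)\<^sup>2)) \<and>
            (\<lambda>n. real (max_scaffold_size d n)) \<in> \<Theta>(\<lambda>n. (real n)\<^sup>2))"
proof (intro conjI impI)
  assume d: "d \<le> 3"
  have "real (card P) \<le> real ((d + 1)\<^sup>2) * real (card (minima Q))"
    if "interval_in d Q" "initial_scaffold P Q" for Q P
    using card_scaffold_le_linear[OF that d] by (metis of_nat_le_iff of_nat_mult)
  then show "\<exists>c C :: real. c > 0 \<and> C > 0 \<and>
      (\<forall>Q P n. interval_in d Q \<and> card (minima Q) = n \<and> initial_scaffold P Q \<longrightarrow>
         finite P \<and> c * real n \<le> real (card P) \<and> real (card P) \<le> C * real n)"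
    using finite_scaffold card_minima_le_scaffold
    by (intro exI[of _ 1] exI[of _ "real ((d + 1)\<^sup>2)"]) auto
next
  have "real (card P) \<le> real (d + 1) * (real (card (minima Q)))\<^sup>2"
    if "interval_in d Q" "initial_scaffold P Q" for Q P
    using card_scaffold_le_square[OF that] by (metis of_nat_le_iff of_nat_mult of_nat_power)
  then show "\<exists>C :: real. C > 0 \<and>
      (\<forall>Q P n. interval_in d Q \<and> card (minima Q) = n \<and> initial_scaffold P Q \<longrightarrow>
         finite P \<and> real (card P) \<le> C * (real n)\<^sup>2)"
    using finite_scaffold by (intro exI[of _ "real (d + 1)"]) auto
next
  assume "d > 3"
  then show "(\<lambda>n. real (max_scaffold_size d n)) \<in> \<Theta>(\<lambda>n. (real n)\<^sup>2)"
    by (rule max_scaffold_size_bigtheta)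
qed

end
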